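(* Let $n,k\in\mathbb{N}$ with $n\ge2$ and $k\ge1$. For any entry-permuting map $A$ on $J_n^{S_{\Delta_{2k}}}$, $$|\mathrm{TC}(A)|\cdot|\mathrm{FP}(A)|=|J_n^{S_{\Delta_{2k}}}|=n^{(2^{k+1})}.$$
   Context: $S_{\Delta_{2k}}=\mathbb{C}^{2^k}/(\mathbb{Z}^{2^k}\oplus i\mathbb{Z}^{2^k})$ and $J_n^{S_{\Delta_{2k}}}=\{x\in S_{\Delta_{2k}}:n\cdot x=0\}$. An element $\vec v\in J_n^{S_{\Delta_{2k}}}$ is a vector of length $2^k$ whose $l$th component is $\frac{a_l}{n}+\frac{b_l}{n}i$ with $a_l,b_l\in\{0,\dots,n-1\}$; its matrix form is the $2^k\times2$ matrix with $l$th row $(a_l,b_l)$. The entries of the matrix form are numbered row-wise from top to bottom, so $\vec v[2l-1]=a_l$ and $\vec v[2l]=b_l$; addition of $n$-torsion points is entrywise addition mod $n$. A map $A:J_n^{S_{\Delta_{2k}}}\to J_n^{S_{\Delta_{2k}}}$ is entry-permuting if it is induced by a permutation $\sigma$ of $\{1,\dots,2^{k+1}\}$: whenever $\sigma(i)=j$, $(A\cdot\vec v)[j]=\vec v[i]$ for every $\vec v\in J_n^{S_{\Delta_{2k}}}$. $\mathrm{FP}(A)=\{\vec v\in J_n^{S_{\Delta_{2k}}}:A\cdot\vec v=\vec v\}$ is the set of fixed points, and $\mathrm{TC}(A)=\{\vec v\in J_n^{S_{\Delta_{2k}}}:A\cdot\vec w=\vec v+\vec w\text{ for some }\vec w\in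 J_n^{S_{\Delta_{2k}}}\}$ is the set of translation constants. *)

theory Defs
  imports
    Complex_Main
    "HOL-Algebra.Coset"
    "HOL-Combinatorics.Permutations"
    "Jordan_Normal_Form.Matrix"
begin

definition gauss_lattice :: "nat \<Rightarrow> complex vec set" where
  "gauss_lattice k = {z \<in> carrier_vec (2 ^ k). \<forall>l < 2 ^ k. Re (z $ l) \<in> \<int> \<and> Im (z $ l) \<in> \<int>}"

definition torus :: "nat \<Rightarrow> complex vec set monoid" where
  "torus k = monoid_vec TYPE(complex) (2 ^ k) Mod gauss_lattice k"

text \<open>The group of the torus is written multiplicatively, so \<open>x [^] n\<close> stands for \<open>n \<cdot> x\<close>
  and \<open>x \<otimes> y\<close> for \<open>x + y\<close>.\<close>

definition torsion_points :: "nat \<Rightarrow> nat \<Rightarrow> complex vec set set" where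
  "torsion_points n k = {x \<in> carrier (torus k). x [^]\<^bsub>torus k\<^esub> n = \<one>\<^bsub>torus k\<^esub>}"

definition point_of_matrix :: "nat \<Rightarrow> nat \<Rightarrow> nat mat \<Rightarrow> complex vec set" where
  "point_of_matrix n k M =
     gauss_lattice k #>\<^bsub>monoid_vec TYPE(complex) (2 ^ k)\<^esub>
       vec (2 ^ k) (\<lambda>l. of_nat (M $$ (l, 0)) / of_nat n + of_nat (M $$ (l, 1)) / of_nat n * \<i>)"

definition is_matrix_form :: "nat \<Rightarrow> nat \<Rightarrow> nat mat \<Rightarrow> complex vec set \<Rightarrow> bool" where
  "is_matrix_form n k M v \<longleftrightarrow>
     M \<in> carrier_mat (2 ^ k) 2 \<and> (\<forall>l < 2 ^ k. \<forall>c < 2. M $$ (l, c) < n) \<and> point_of_matrix n k M = v"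

text \<open>For \<open>n \<ge> 1\<close> every \<open>n\<close>-torsion point has exactly one matrix form.\<close>

definition matrix_form :: "nat \<Rightarrow> nat \<Rightarrow> complex vec set \<Rightarrow> nat mat" where
  "matrix_form n k v = (THE M. is_matrix_form n k M v)"

text \<open>Matrix rows and columns are indexed from 0, whereas the row-wise numbering of the
  entries runs over \<open>m = 1, \<dots>, 2 ^ (k + 1)\<close>.\<close>

definition entry :: "nat \<Rightarrow> nat \<Rightarrow> complex vec set \<Rightarrow> nat \<Rightarrow> nat" where
  "entry n k v m = matrix_form n k v $$ ((m - 1) div 2, (m - 1) mod 2)"

definition entry_permuting :: "nat \<Rightarrow> nat \<Rightarrow> (complex vec set \<Rightarrow> complex vec set) \<Rightarrow> bool" where
  "entry_permuting n k A \<longleftrightarrow>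
     A \<in> torsion_points n k \<rightarrow> torsion_points n k \<and>
     (\<exists>\<sigma>. \<sigma> permutes {1..2 ^ (k + 1)} \<and>
        (\<forall>v \<in> torsion_points n k. \<forall>i \<in> {1..2 ^ (k + 1)}. \<forall>j \<in> {1..2 ^ (k + 1)}.
           \<sigma> i = j \<longrightarrow> entry n k (A v) j = entry n k v i))"

definition FP :: "nat \<Rightarrow> nat \<Rightarrow> (complex vec set \<Rightarrow> complex vec set) \<Rightarrow> complex vec set set" where
  "FP n k A = {v \<in> torsion_points n k. A v = v}"

definition TC :: "nat \<Rightarrow> nat \<Rightarrow> (complex vec set \<Rightarrow> complex vec set) \<Rightarrow> complex vec set set" where
  "TC n k A = {v \<in> torsion_points n k. \<exists>w \<in> torsion_points n k. A w = v \<otimes>\<^bsub>torus k\<^esub> w}"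

end

theory Submission
  imports Defs
begin

text \<open>An entry-permuting map is induced by a permutation of real coordinates, hence is an
  endomorphism of the finite abelian group of torsion points. The translation constants are the
  image and the fixed points the kernel of \<open>w \<mapsto> A w - w\<close>, so the first equality is the first
  isomorphism theorem combined with Lagrange's theorem.\<close>

section \<open>Image and kernel counts for group homomorphisms\<close>

lemma (in group_hom) card_image_times_card_kernel:
  "card (h ` carrier G) * card (kernel G H h) = order G"
proof -
  \<comment> \<open>Shrinking the codomain to the image makes \<open>h\<close> surjective, as
    \<open>FactGroup_iso_set\<close> requires; the kernel stays the same.\<close>
  let ?H = "H\<lparr>carrier := h ` carrier G\<rparr>"
  have "group ?H"
    using img_is_subgroup by (simp add: H.subgroup_imp_group)
  moreover have "h \<in> hom G ?H"
    using homh by (auto simp: hom_def)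
  ultimately interpret img: group_hom G ?H h
    by (simp add: group_hom_def group_hom_axioms_def)
  have "bij_betw (\<lambda>X. the_elem (h ` X)) (carrier (G Mod kernel G ?H h)) (carrier ?H)"
    using img.FactGroup_iso_set by (simp add: iso_def)
  moreover have "carrier (G Mod kernel G ?H h) = rcosets (kernel G ?H h)"
    by (simp add: FactGroup_def)
  moreover have "kernel G ?H h = kernel G H h"
    by (simp add: kernel_def)
  ultimately have "card (rcosets (kernel G H h)) = card (h ` carrier G)"
    by (simp add: bij_betw_same_card)
  then show ?thesis
    using G.lagrange[OF subgroup_kernel] by simp
qed

text \<open>Commutativity makes the displacement map \<open>h\<close> of \<open>A\<close> a
  homomorphism, so the image-kernel count applies to it.\<close>

lemma (in comm_group) card_displacements_times_card_fixed_points: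
  assumes A: "A \<in> hom G G"
  shows "card {v \<in> carrier G. \<exists>w \<in> carrier G. A w = v \<otimes> w}
       * card {v \<in> carrier G. A v = v} = order G"
proof -
  define h where "h = (\<lambda>w. A w \<otimes> inv w)"
  have A_closed: "A w \<in> carrier G" if "w \<in> carrier G" for w
    using A that by (rule hom_in_carrier)
  have "A (v \<otimes> w) = A v \<otimes> A w" if "v \<in> carrier G" "w \<in> carrier G" for v w
    using A that by (rule hom_mult)
  then have "h \<in> hom G G"
    by (intro homI) (simp_all add: h_def A_closed inv_mult m_ac)
  then interpret h: group_hom G G h
    by (simp add: group_hom_def group_hom_axioms_def)
  \<comment> \<open>Used twice: letting \<open>w\<close> vary gives the image of \<open>h\<close>,
    and taking \<open>v\<close> to be the unit gives its kernel.\<close>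
  have solve: "A w = v \<otimes> w \<longleftrightarrow> v = h w" if "v \<in> carrier G" "w \<in> carrier G" for v w
    unfolding h_def using that A_closed inv_solve_right by blast
  have "{v \<in> carrier G. \<exists>w \<in> carrier G. A w = v \<otimes> w} = h ` carrier G"
    using solve by auto
  moreover have "{v \<in> carrier G. A v = v} = kernel G G h"
    using solve[of \<one>] by (auto simp: kernel_def eq_commute[of "\<one>"])
  ultimately show ?thesis
    using h.card_image_times_card_kernel by simp
qed

section \<open>The torus as a quotient group\<close>

interpretation vec_group: comm_group "monoid_vec TYPE(complex) d" for d
  by (rule comm_group_vec)

lemma inv_monoid_vec:
  assumes "z \<in> carrier_vec d"
  shows "inv\<^bsub>monoid_vec TYPE(complex) d\<^esub> z = - z"
  using assms by (intro vec_group.inv_equality) (auto simp: monoid_vec_simps)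

lemma subgroup_gauss_lattice:
  "subgroup (gauss_lattice k) (monoid_vec TYPE(complex) (2 ^ k))"
proof (rule vec_group.subgroupI)
  have "0\<^sub>v (2 ^ k) \<in> gauss_lattice k"
    by (simp add: gauss_lattice_def)
  then show "gauss_lattice k \<noteq> {}"
    by blast
qed (auto simp: gauss_lattice_def monoid_vec_simps inv_monoid_vec)

interpretation gauss: normal "gauss_lattice k" "monoid_vec TYPE(complex) (2 ^ k)" for k
  using subgroup_gauss_lattice vec_group.normal_iff_subgroup by blast

interpretation torus: comm_group "torus k" for k
  unfolding torus_def by (rule vec_group.abelian_FactGroup) (rule subgroup_gauss_lattice)

section \<open>Real coordinates on the torus\<close>

text \<open>Arguments of \<open>f\<close> follow the row-wise numbering of entries from 1. Total
  functions are used so that addition is pointwise and permuting coordinates is composition.\<close>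

definition real_vec :: "nat \<Rightarrow> (nat \<Rightarrow> real) \<Rightarrow> complex vec" where
  "real_vec k f = vec (2 ^ k) (\<lambda>l. Complex (f (2 * l + 1)) (f (2 * l + 2)))"

text \<open>Arbitrary real representatives spare the group law any reduction mod
  \<open>n\<close>.\<close>

definition real_point :: "nat \<Rightarrow> (nat \<Rightarrow> real) \<Rightarrow> complex vec set" where
  "real_point k f = gauss_lattice k #>\<^bsub>monoid_vec TYPE(complex) (2 ^ k)\<^esub> real_vec k f"

text \<open>Links the numbering of entries from 1 with the numbering of vector components from
  0.\<close>

lemma ball_entries_iff:
  fixes P :: "nat \<Rightarrow> bool"
  shows "(\<forall>m \<in> {1..2 ^ (k + 1)}. P m) \<longleftrightarrow> (\<forall>l < 2 ^ k. P (2 * l + 1) \<and> P (2 * l + 2))"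
proof
  assume R: "\<forall>l < 2 ^ k. P (2 * l + 1) \<and> P (2 * l + 2)"
  show "\<forall>m \<in> {1..2 ^ (k + 1)}. P m"
  proof
    fix m :: nat assume m: "m \<in> {1..2 ^ (k + 1)}"
    then have "(m - 1) div 2 < 2 ^ k" by auto
    moreover have "m = 2 * ((m - 1) div 2) + 1 \<or> m = 2 * ((m - 1) div 2) + 2"
      using m by auto
    ultimately show "P m" using R by metis
  qed
qed auto

lemma real_vec_carrier [simp]: "real_vec k f \<in> carrier_vec (2 ^ k)"
  by (simp add: real_vec_def)

lemma real_vec_add: "real_vec k f + real_vec k g = real_vec k (\<lambda>m. f m + g m)"
  by (rule eq_vecI) (auto simp: real_vec_def complex_eq_iff)

lemma carrier_torus: "carrier (torus k) = range (real_point k)"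
proof -
  have "\<exists>f. z = real_vec k f" if "z \<in> carrier_vec (2 ^ k)" for z
  proof
    \<comment> \<open>Coordinate \<open>m\<close> belongs to component \<open>(m - 1) div 2\<close>,
      and its parity selects the real or imaginary part.\<close>
    show "z = real_vec k (\<lambda>m. if odd m then Re (z $ ((m - 1) div 2)) else Im (z $ ((m - 1) div 2)))"
      using that by (auto simp: real_vec_def)
  qed
  then have "carrier_vec (2 ^ k) = range (real_vec k)"
    by auto
  then show ?thesis
    by (auto simp: torus_def carrier_FactGroup real_point_def monoid_vec_simps)
qed

lemma real_point_in_torus [simp]: "real_point k f \<in> carrier (torus k)"
  by (simp add: carrier_torus)

text \<open>Cosets agree exactly when the difference of representatives lies in the lattice, which
  is tested coordinate by coordinate.\<close>

lemma real_point_eq_iff: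
  "real_point k f = real_point k g \<longleftrightarrow> (\<forall>m \<in> {1..2 ^ (k + 1)}. f m - g m \<in> \<int>)"
proof -
  have "real_point k f = real_point k g \<longleftrightarrow> real_vec k f \<in> real_point k g"
    unfolding real_point_def
    using vec_group.repr_independence[OF _ _ subgroup_gauss_lattice]
      vec_group.rcos_self[OF _ subgroup_gauss_lattice]
    by (metis monoid_vec_simps(2) real_vec_carrier)
  also have "\<dots> \<longleftrightarrow> real_vec k f - real_vec k g \<in> gauss_lattice k"
    unfolding real_point_def
    using gauss.rcos_module[OF vec_group.is_group, of "real_vec k g" k "real_vec k f"]
    by (simp add: monoid_vec_simps inv_monoid_vec minus_add_uminus_vec[of _ "2 ^ k"])
  also have "\<dots> \<longleftrightarrow> (\<forall>m \<in> {1..2 ^ (k + 1)}. f m - g m \<in> \<int>)"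
    unfolding ball_entries_iff by (auto simp: gauss_lattice_def real_vec_def)
  finally show ?thesis .
qed

lemma real_point_mult:
  "real_point k f \<otimes>\<^bsub>torus k\<^esub> real_point k g = real_point k (\<lambda>m. f m + g m)"
  using gauss.rcos_sum[of "real_vec k f" k "real_vec k g"]
  by (simp add: torus_def real_point_def monoid_vec_simps real_vec_add)

text \<open>The zero point is idempotent, and by cancellation the unit is the only idempotent of a
  group.\<close>

lemma one_torus: "\<one>\<^bsub>torus k\<^esub> = real_point k (\<lambda>_. 0)"
  using real_point_mult[of k "\<lambda>_. 0" "\<lambda>_. 0"]
    torus.r_cancel_one[OF real_point_in_torus[of k "\<lambda>_. 0"] real_point_in_torus[of k "\<lambda>_. 0"]]
  by simp

lemma real_point_pow:
  "real_point k f [^]\<^bsub>torus k\<^esub> (n :: nat) = real_point k (\<lambda>m. real n * f m)"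
  by (induction n) (simp_all add: one_torus real_point_mult algebra_simps)

section \<open>Torsion points and their matrix forms\<close>

lemma real_point_in_torsion_points_iff:
  "real_point k f \<in> torsion_points n k \<longleftrightarrow> (\<forall>m \<in> {1..2 ^ (k + 1)}. real n * f m \<in> \<int>)"
  by (simp add: torsion_points_def real_point_pow one_torus real_point_eq_iff)

lemma subgroup_torsion_points: "subgroup (torsion_points n k) (torus k)"
proof (rule torus.subgroupI)
  show "torsion_points n k \<noteq> {}"
    using torus.one_closed torus.nat_pow_one unfolding torsion_points_def by blast
qed (auto simp: torsion_points_def torus.nat_pow_inv torus.nat_pow_distrib)

lemma point_of_matrix_conv_real_point:
  "point_of_matrix n k M =
     real_point k (\<lambda>m. real (M $$ ((m - 1) div 2, (m - 1) mod 2)) / real n)"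
proof -
  have "complex_of_nat a / of_nat n + of_nat b / of_nat n * \<i>
      = Complex (real a / real n) (real b / real n)" for a b
    by (simp add: complex_eq_iff)
  then show ?thesis
    by (simp add: point_of_matrix_def real_point_def real_vec_def)
qed

text \<open>Clearing denominators gives a congruence mod \<open>n\<close> between two reduced
  residues.\<close>

lemma nat_eq_if_divide_diff_in_Ints:
  assumes "a < n" "b < n" and "real a / real n - real b / real n \<in> \<int>"
  shows "a = b"
proof -
  from assms(3) obtain c where "real a / real n - real b / real n = of_int c"
    by (auto elim: Ints_cases)
  then have "real a - real b = of_int c * real n"
    using assms(1) by (simp add: field_simps)
  then have "int a - int b = c * int n"
    by (metis of_int_diff of_int_eq_iff of_int_mult of_int_of_nat_eq)
  then have "int a mod int n = int b mod int n"
    by (metis mod_eq_dvd_iff dvd_triv_right)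
  then show ?thesis
    using assms(1,2) by simp
qed

text \<open>The uniqueness needed to evaluate the \<open>THE\<close> in
  \<open>matrix_form\<close>.\<close>

lemma is_matrix_form_unique:
  assumes "is_matrix_form n k M v" and "is_matrix_form n k M' v"
  shows "M = M'"
proof (rule eq_matI)
  fix l c assume "l < dim_row M'" "c < dim_col M'"
  then have l: "l < 2 ^ k" and c: "c < 2"
    using assms(2) by (auto simp: is_matrix_form_def)
  \<comment> \<open>The row-wise number of position \<open>(l, c)\<close>:
    \<open>(?m - 1) div 2\<close> recovers \<open>l\<close> and \<open>(?m - 1) mod 2\<close>
    recovers \<open>c\<close>.\<close>
  let ?m = "2 * l + c + 1"
  have m: "?m \<in> {1..2 ^ (k + 1)}"
    using l c by auto
  have eq: "real_point k (\<lambda>m. real (M $$ ((m - 1) div 2, (m - 1) mod 2)) / real n)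
      = real_point k (\<lambda>m. real (M' $$ ((m - 1) div 2, (m - 1) mod 2)) / real n)"
    using assms by (simp add: is_matrix_form_def point_of_matrix_conv_real_point)
  have "real (M $$ (l, c)) / real n - real (M' $$ (l, c)) / real n \<in> \<int>"
    using bspec[OF iffD1[OF real_point_eq_iff eq] m] c by simp
  then show "M $$ (l, c) = M' $$ (l, c)"
    using assms l c by (intro nat_eq_if_divide_diff_in_Ints) (auto simp: is_matrix_form_def)
qed (use assms in \<open>auto simp: is_matrix_form_def\<close>)

text \<open>Filling a matrix with the numerators exhibits a matrix form, and uniqueness makes it the
  chosen one.\<close>

lemma entry_real_point:
  assumes a: "\<And>m. m \<in> {1..2 ^ (k + 1)} \<Longrightarrow> a m < n" and m: "m \<in> {1..2 ^ (k + 1)}"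
  shows "entry n k (real_point k (\<lambda>m. real (a m) / real n)) m = a m"
proof -
  let ?v = "real_point k (\<lambda>m. real (a m) / real n)"
  define M where "M = mat (2 ^ k) 2 (\<lambda>(l, c). a (2 * l + c + 1))"
  have M_entry: "M $$ ((m - 1) div 2, (m - 1) mod 2) = a m" if "m \<in> {1..2 ^ (k + 1)}" for m
  proof -
    have "(m - 1) div 2 < 2 ^ k"
      using that by auto
    moreover have "2 * ((m - 1) div 2) + (m - 1) mod 2 + 1 = m"
      using that by simp
    ultimately show ?thesis
      by (simp add: M_def)
  qed
  have "is_matrix_form n k M ?v"
    unfolding is_matrix_form_def point_of_matrix_conv_real_point real_point_eq_iff
    by (auto simp: M_entry M_def intro!: a)
  then have "matrix_form n k ?v = M"
    unfolding matrix_form_def by (blast intro: is_matrix_form_unique)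
  then show ?thesis
    using M_entry[OF m] by (simp add: entry_def)
qed

text \<open>Every torsion point has reduced numerators: scaling a coordinate by \<open>n\<close>
  gives an integer, which may be reduced mod \<open>n\<close>.\<close>

lemma torsion_point_cases:
  assumes "v \<in> torsion_points n k" and "n > 0"
  obtains a where "\<And>m. a m < n" and "v = real_point k (\<lambda>m. real (a m) / real n)"
proof -
  from assms obtain f where f: "v = real_point k f"
    by (auto simp: torsion_points_def carrier_torus)
  with assms have int: "real n * f m \<in> \<int>" if "m \<in> {1..2 ^ (k + 1)}" for m
    using that by (simp add: real_point_in_torsion_points_iff)
  \<comment> \<open>On the index range the floor only changes the type of an integer; elsewhere it
    keeps \<open>a\<close> total and below \<open>n\<close>.\<close>
  define a where "a = (\<lambda>m. nat (\<lfloor>real n * f m\<rfloor> mod int n))"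
  have "f m - real (a m) / real n \<in> \<int>" if m: "m \<in> {1..2 ^ (k + 1)}" for m
  proof -
    let ?c = "\<lfloor>real n * f m\<rfloor>"
    have "real n * f m = of_int ?c"
      using int[OF m] by (simp add: of_int_floor)
    also have "?c = (?c div int n) * int n + int (a m)"
      using assms by (simp add: a_def)
    finally have "real n * f m = real_of_int (?c div int n) * real n + real (a m)"
      by simp
    then have "f m - real (a m) / real n = of_int (?c div int n)"
      using assms by (simp add: field_simps)
    then show ?thesis by simp
  qed
  then have "v = real_point k (\<lambda>m. real (a m) / real n)"
    by (simp add: f real_point_eq_iff)
  moreover have "a m < n" for m
    using assms by (simp add: a_def nat_less_iff)
  ultimately show ?thesis
    using that by blast
qed

lemma entry_less:
  assumes "v \<in> torsion_points n k" "n > 0" "m \<in> {1..2 ^ (k + 1)}"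
  shows "entry n k v m < n"
proof -
  from assms(1,2) obtain a where a: "\<And>m. a m < n" and v: "v = real_point k (\<lambda>m. real (a m) / real n)"
    by (rule torsion_point_cases) blast
  show ?thesis
    unfolding v entry_real_point[of k a n, OF a assms(3)] by (rule a)
qed

text \<open>With \<open>entry_real_point\<close>, this makes reading off entries and building a
  point mutually inverse.\<close>

lemma real_point_entry:
  assumes "v \<in> torsion_points n k" "n > 0"
  shows "real_point k (\<lambda>m. real (entry n k v m) / real n) = v"
proof -
  from assms obtain a where a: "\<And>m. a m < n" and v: "v = real_point k (\<lambda>m. real (a m) / real n)"
    by (rule torsion_point_cases) blast
  have "entry n k v m = a m" if "m \<in> {1..2 ^ (k + 1)}" for m
    unfolding v using a that by (rule entry_real_point)
  then show ?thesis
    unfolding v by (simp add: real_point_eq_iff)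
qed

section \<open>Counting torsion points\<close>

lemma card_torsion_points:
  assumes "n > 0"
  shows "card (torsion_points n k) = n ^ (2 ^ (k + 1))"
proof -
  let ?I = "{1..2 ^ (k + 1)} :: nat set"
  \<comment> \<open>\<open>restrict\<close> fixes the value outside \<open>?I\<close>, so that each
    tuple of entries is a single element of the extensional function space.\<close>
  have "bij_betw (\<lambda>v. restrict (entry n k v) ?I) (torsion_points n k) (?I \<rightarrow>\<^sub>E {..<n})"
  proof (rule bij_betw_byWitness[where f' = "\<lambda>a. real_point k (\<lambda>m. real (a m) / real n)"])
    show "\<forall>v \<in> torsion_points n k.
        real_point k (\<lambda>m. real (restrict (entry n k v) ?I m) / real n) = v"
    proof
      fix v assume v: "v \<in> torsion_points n k"
      have "real_point k (\<lambda>m. real (restrict (entry n k v) ?I m) / real n)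
          = real_point k (\<lambda>m. real (entry n k v m) / real n)"
        by (simp add: real_point_eq_iff)
      then show "real_point k (\<lambda>m. real (restrict (entry n k v) ?I m) / real n) = v"
        using real_point_entry[OF v assms] by simp
    qed
    show "\<forall>a \<in> ?I \<rightarrow>\<^sub>E {..<n}.
        restrict (entry n k (real_point k (\<lambda>m. real (a m) / real n))) ?I = a"
    proof
      fix a assume a: "a \<in> ?I \<rightarrow>\<^sub>E {..<n}"
      show "restrict (entry n k (real_point k (\<lambda>m. real (a m) / real n))) ?I = a"
      proof (rule PiE_ext)
        show "restrict (entry n k (real_point k (\<lambda>m. real (a m) / real n))) ?I m = a m"
          if m: "m \<in> ?I" for m
        proof -
          have "a i < n" if "i \<in> ?I" for i
            using a that by blast
          then show ?thesis
            using m by (simp only: entry_real_point restrict_apply if_True)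
        qed
        then show "restrict (entry n k (real_point k (\<lambda>m. real (a m) / real n))) ?I
            \<in> ?I \<rightarrow>\<^sub>E {..<n}"
          using a by (auto simp: PiE_iff)
      qed (use a in auto)
    qed
    show "(\<lambda>v. restrict (entry n k v) ?I) ` torsion_points n k \<subseteq> ?I \<rightarrow>\<^sub>E {..<n}"
      using entry_less assms by (auto simp: PiE_iff simp del: atLeastAtMost_iff)
    show "(\<lambda>a. real_point k (\<lambda>m. real (a m) / real n)) ` (?I \<rightarrow>\<^sub>E {..<n}) \<subseteq> torsion_points n k"
      using assms by (auto simp: real_point_in_torsion_points_iff)
  qed
  then have "card (torsion_points n k) = card (?I \<rightarrow>\<^sub>E {..<n})"
    by (rule bij_betw_same_card)
  then show ?thesis
    by (simp add: card_PiE)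
qed

section \<open>Entry-permuting maps as endomorphisms\<close>

text \<open>Carries the permutation from reduced entries over to arbitrary representatives, with one
  \<open>\<tau>\<close> for all points. Representatives differ from entries over \<open>n\<close> by
  integers, and reindexing preserves this.\<close>

lemma entry_permuting_on_real_point:
  assumes A: "entry_permuting n k A" and n: "n > 0"
  obtains \<tau> where "\<And>f. real_point k f \<in> torsion_points n k \<Longrightarrow>
    A (real_point k f) = real_point k (f \<circ> \<tau>)"
proof -
  let ?I = "{1..2 ^ (k + 1)} :: nat set"
  from A obtain \<sigma> where maps: "A \<in> torsion_points n k \<rightarrow> torsion_points n k"
    and \<sigma>: "\<sigma> permutes ?I"
    and entry: "\<And>v i. v \<in> torsion_points n k \<Longrightarrow> i \<in> ?I \<Longrightarrow> \<sigma> i \<in> ?I \<Longrightarrow>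
        entry n k (A v) (\<sigma> i) = entry n k v i"
    unfolding entry_permuting_def by blast
  \<comment> \<open>\<open>\<sigma>\<close> sends old positions to new ones, so the entry found at a
    new position comes from its preimage.\<close>
  define \<tau> where "\<tau> = inv_into UNIV \<sigma>"
  have inv_in: "\<tau> m \<in> ?I" if "m \<in> ?I" for m
    using permutes_in_image[OF permutes_inv[OF \<sigma>]] that unfolding \<tau>_def by blast
  have "A (real_point k f) = real_point k (f \<circ> \<tau>)"
    if f: "real_point k f \<in> torsion_points n k" for f
  proof -
    let ?v = "real_point k f"
    have Av: "A ?v \<in> torsion_points n k"
      using maps f by blast
    have entry_A: "entry n k (A ?v) m = entry n k ?v (\<tau> m)" if m: "m \<in> ?I" for m
      using entry[OF f inv_in[OF m]] permutes_inverses(1)[OF \<sigma>, of m] m by (simp add: \<tau>_def)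
    have "f m - real (entry n k ?v m) / real n \<in> \<int>" if "m \<in> ?I" for m
      using real_point_entry[OF f n] that by (metis real_point_eq_iff)
    then have "f (\<tau> m) - real (entry n k (A ?v) m) / real n \<in> \<int>" if "m \<in> ?I" for m
      using that inv_in entry_A by metis
    then have "real_point k (f \<circ> \<tau>) = real_point k (\<lambda>m. real (entry n k (A ?v) m) / real n)"
      unfolding real_point_eq_iff by simp
    then show ?thesis
      using real_point_entry[OF Av n] by simp
  qed
  then show ?thesis
    by (rule that[of \<tau>])
qed

text \<open>Composition with a fixed \<open>\<tau>\<close> distributes over pointwise sums.\<close>

lemma entry_permuting_hom:
  assumes A: "entry_permuting n k A" and n: "n > 0"
  shows "A \<in> hom (torus k\<lparr>carrier := torsion_points n k\<rparr>) (torus k\<lparr>carrier := torsion_points n k\<rparr>)"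
proof (rule homI; simp)
  show "A v \<in> torsion_points n k" if "v \<in> torsion_points n k" for v
    using A that by (auto simp: entry_permuting_def)
  fix v w assume vw: "v \<in> torsion_points n k" "w \<in> torsion_points n k"
  then obtain f g where v: "v = real_point k f" and w: "w = real_point k g"
    by (auto simp: torsion_points_def carrier_torus)
  obtain \<tau> where \<tau>: "\<And>f. real_point k f \<in> torsion_points n k \<Longrightarrow>
      A (real_point k f) = real_point k (f \<circ> \<tau>)"
    using entry_permuting_on_real_point[OF A n] by blast
  \<comment> \<open>The formula for \<open>A\<close> holds only on torsion points, so the sum must
    be one too.\<close>
  have "v \<otimes>\<^bsub>torus k\<^esub> w \<in> torsion_points n k"
    using subgroup_torsion_points vw by (rule subgroup.m_closed)
  then show "A (v \<otimes>\<^bsub>torus k\<^esub> w) = A v \<otimes>\<^bsub>torus k\<^esub> A w"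
    using vw by (simp add: v w real_point_mult \<tau> comp_def)
qed

theorem corollary7p10:
  fixes n k :: nat and A :: "complex vec set \<Rightarrow> complex vec set"
  assumes "n \<ge> 2" and "k \<ge> 1" and "entry_permuting n k A"
  shows "card (TC n k A) * card (FP n k A) = card (torsion_points n k)
         \<and> card (torsion_points n k) = n ^ (2 ^ (k + 1))"
proof
  have n: "n > 0"
    using assms(1) by simp
  \<comment> \<open>Only the carrier changes, so \<open>TC\<close> and \<open>FP\<close> unfold to
    the displacement and fixed-point sets of this group.\<close>
  interpret J: comm_group "torus k\<lparr>carrier := torsion_points n k\<rparr>"
    using torus.subgroup_imp_group[OF subgroup_torsion_points]
    by (rule group.group_comm_groupI) (simp add: torsion_points_def torus.m_comm)
  show "card (TC n k A) * card (FP n k A) = card (torsion_points n k)"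
    using J.card_displacements_times_card_fixed_points[OF entry_permuting_hom[OF assms(3) n]]
    by (simp add: TC_def FP_def order_def)
  show "card (torsion_points n k) = n ^ (2 ^ (k + 1))"
    using n by (rule card_torsion_points)
qed

end
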